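(* Let $n \in \mathbb{N}$ and $z \in \mathbb{C}$ such that $\Re(z) \in \mathbb{R} \setminus \{0\}$. Define $$\phi_n(z) = \sum_{k \in \mathbb{Z}} \frac{1}{k^{2^n} + z^{2^n}}.$$ Then the following recursive relation holds: $$\phi_n(z) = \frac{\phi_{n-1}\left(i^{3 \cdot 2^{1-n}} z\right) - \phi_{n-1}\left(i^{2^{1-n}} z\right)}{2 i\, z^{2^{n-1}}},$$ where $i = \sqrt{-1}$.
   Context: $\mathbb{N}$ denotes the positive integers, and $\phi_{n-1}$ is given by the same series with $n$ replaced by $n-1$, i.e. $\phi_{n-1}(w) = \sum_{k \in \mathbb{Z}} \frac{1}{k^{2^{n-1}} + w^{2^{n-1}}}$.
   Formalization: It is additionally assumed that no denominator k^{2^n}+z^{2^n} vanishes, since Re(z) ≠ 0 alone leaves φ_n(z) undefined at e.g. n=2, z=e^{iπ/4}; the series are read as limits of symmetric partial sums, which matters only for φ_0. *)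

theory Defs
  imports "HOL-Analysis.Analysis"
begin

text \<open>
  The series over all integers is the limit of its symmetric partial sums. For \<open>n \<ge> 1\<close> it
  converges absolutely and this is the unordered sum (\<open>phi_has_sum\<close> below), but the case
  \<open>n = 0\<close>, the series of \<open>1 / (k + w)\<close>, converges only conditionally and has to be read as a
  principal value.
\<close>

definition phi_term :: "nat \<Rightarrow> complex \<Rightarrow> int \<Rightarrow> complex" where
  "phi_term n w k = 1 / (of_int k ^ (2 ^ n) + w ^ (2 ^ n))"

definition phi :: "nat \<Rightarrow> complex \<Rightarrow> complex" where
  "phi n w = lim (\<lambda>N. \<Sum>k = - int N..int N. phi_term n w k)"

lemma summable_on_int:
  fixes g :: "int \<Rightarrow> complex"
  assumes "summable (\<lambda>n. norm (g (int n)))" "summable (\<lambda>n. norm (g (- int n)))"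
  shows "g summable_on UNIV"
proof -
  have a: "g summable_on range int"
    using norm_summable_imp_summable_on[OF assms(1)]
    by (subst summable_on_reindex) (auto simp: o_def inj_on_def)
  have b: "g summable_on range (\<lambda>n. - int n)"
    using norm_summable_imp_summable_on[OF assms(2)]
    by (subst summable_on_reindex) (auto simp: o_def inj_on_def)
  have "k \<in> range int \<union> range (\<lambda>n. - int n)" for k :: int
    by (cases k rule: int_cases2) auto
  then have "(UNIV :: int set) = range int \<union> range (\<lambda>n. - int n)" by auto
  then show ?thesis using summable_on_union[OF a b] by simp
qed

lemma symmetric_partial_sums_LIMSEQ:
  fixes g :: "int \<Rightarrow> complex"
  assumes "(g has_sum s) UNIV"
  shows "(\<lambda>N. \<Sum>k = - int N..int N. g k) \<longlonglongrightarrow> s"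
proof -
  have "filterlim (\<lambda>N. {- int N..int N}) (finite_subsets_at_top UNIV) sequentially"
    unfolding filterlim_finite_subsets_at_top
  proof (intro allI impI)
    fix X :: "int set" assume "finite X \<and> X \<subseteq> UNIV"
    then have fin: "finite X" by simp
    define M where "M = Max (insert 0 (abs ` X))"
    have M: "\<bar>x\<bar> \<le> M" if "x \<in> X" for x
      unfolding M_def using fin that by (intro Max_ge) auto
    show "\<forall>\<^sub>F N in sequentially. finite {- int N..int N} \<and> X \<subseteq> {- int N..int N} \<and> {- int N..int N} \<subseteq> UNIV"
      using eventually_ge_at_top[of "nat M"]
    proof eventually_elim
      case (elim N)
      then have "\<bar>x\<bar> \<le> int N" if "x \<in> X" for x using M[OF that] by linarith
      then show ?case by (force simp: abs_le_iff)
    qed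
  qed
  with assms show ?thesis
    unfolding has_sum_def by (rule filterlim_compose)
qed

lemma summable_norm_phi_term:
  fixes c :: complex
  assumes "n \<ge> 1"
  shows "summable (\<lambda>k. norm (1 / (of_nat k ^ (2 ^ n) + c)))"
proof (rule summable_comparison_test_ev)
  have "filterlim (\<lambda>k::nat. (of_nat k :: real) ^ 2) at_top sequentially"
    by (intro filterlim_pow_at_top filterlim_real_sequentially) auto
  then have "\<forall>\<^sub>F k::nat in sequentially. (of_nat k :: real) ^ 2 \<ge> 2 * norm c + 1"
    by (simp add: filterlim_at_top)
  then show "\<forall>\<^sub>F k::nat in sequentially.
      norm (norm (1 / (of_nat k ^ (2 ^ n) + c))) \<le> 2 * (1 / of_nat k ^ 2)"
    using eventually_ge_at_top[of 1]
  proof eventually_elim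
    case (elim k)
    have "(2::nat) \<le> 2 ^ n" using assms power_increasing[of 1 n "2::nat"] by simp
    then have le: "real k ^ 2 \<le> real k ^ (2 ^ n)"
      using elim by (intro power_increasing) auto
    have "real k ^ (2 ^ n) - norm c \<le> norm (of_nat k ^ (2 ^ n) + c)"
      using norm_diff_ineq[of "of_nat k ^ (2 ^ n)" c] by (simp add: norm_power)
    then have ge: "norm (of_nat k ^ (2 ^ n) + c) \<ge> real k ^ 2 / 2"
      using elim le by linarith
    have pos: "real k ^ 2 / 2 > 0" using elim by simp
    have "1 / norm (of_nat k ^ (2 ^ n) + c) \<le> 1 / (real k ^ 2 / 2)"
      using ge pos by (intro divide_left_mono mult_pos_pos) auto
    then show ?case by (simp add: norm_divide)
  qed
  show "summable (\<lambda>k. 2 * (1 / real k ^ 2))"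
    using inverse_power_summable[of 2, where ?'a = real]
    by (intro summable_mult) (simp add: inverse_eq_divide)
qed

lemma phi_has_sum:
  assumes "n \<ge> 1"
  shows "(phi_term n w has_sum phi n w) UNIV"
proof -
  have "even ((2::nat) ^ n)" using assms by simp
  then have "phi_term n w summable_on UNIV"
    using summable_norm_phi_term[OF assms, of "w ^ (2 ^ n)"]
    by (intro summable_on_int) (simp_all add: phi_term_def)
  then obtain s where s: "(phi_term n w has_sum s) UNIV" by (auto simp: summable_on_def)
  have "phi n w = s"
    unfolding phi_def by (rule limI) (rule symmetric_partial_sums_LIMSEQ[OF s])
  with s show ?thesis by simp
qed

lemma sum_symmetric_int:
  fixes g :: "int \<Rightarrow> complex"
  shows "(\<Sum>k = - int N..int N. g k) = g 0 + (\<Sum>k<N. g (int (Suc k)) + g (- int (Suc k)))"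
proof (induction N)
  case (Suc N)
  have "{- int (Suc N)..int (Suc N)} = insert (int (Suc N)) (insert (- int (Suc N)) {- int N..int N})"
    by auto
  then show ?case using Suc by simp
qed auto

lemma phi_LIMSEQ: "(\<lambda>N. \<Sum>k = - int N..int N. phi_term n w k) \<longlonglongrightarrow> phi n w"
proof (cases "n \<ge> 1")
  case True
  then show ?thesis by (intro symmetric_partial_sums_LIMSEQ phi_has_sum)
next
  case False
  then have n: "n = 0" by simp
  have "filterlim (\<lambda>k::nat. real k) at_top sequentially" by (rule filterlim_real_sequentially)
  then have "\<forall>\<^sub>F k::nat in sequentially. real k \<ge> norm w + 1"
    by (simp add: filterlim_at_top)
  then have ev: "\<forall>\<^sub>F k::nat in sequentially.
      phi_term n w (int k) + phi_term n w (- int k) = (- 2 * w) * (1 / (of_nat k ^ (2 ^ 1) + (- w\<^sup>2)))"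
  proof eventually_elim
    case (elim k)
    have "norm w < norm (of_nat k :: complex)" using elim by simp
    then have ne: "of_nat k + w \<noteq> 0" "of_nat k - w \<noteq> 0"
      by (auto simp: add_eq_0_iff2 dest: arg_cong[where f = norm])
    have "phi_term n w (int k) + phi_term n w (- int k) = 1 / (of_nat k + w) - 1 / (of_nat k - w)"
      using ne by (simp add: phi_term_def n divide_simps) (simp add: algebra_simps)
    also have "\<dots> = (- 2 * w) / ((of_nat k + w) * (of_nat k - w))"
      using ne by (simp add: divide_simps)
    also have "(of_nat k + w) * (of_nat k - w) = of_nat k ^ (2 ^ 1) + (- w\<^sup>2)"
      by (simp add: algebra_simps power2_eq_square)
    finally show ?case by simp
  qed
  have "summable (\<lambda>k. (- 2 * w) * (1 / (of_nat k ^ (2 ^ 1) + (- w\<^sup>2))))"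
    by (intro summable_mult summable_norm_cancel[OF summable_norm_phi_term]) simp
  then have "summable (\<lambda>k. phi_term n w (int k) + phi_term n w (- int k))"
    using summable_cong[OF ev] by simp
  then have "summable (\<lambda>k. phi_term n w (int (Suc k)) + phi_term n w (- int (Suc k)))"
    by (subst (asm) summable_Suc_iff[symmetric])
  then have "(\<lambda>N. \<Sum>k = - int N..int N. phi_term n w k) \<longlonglongrightarrow>
      phi_term n w 0 + (\<Sum>k. phi_term n w (int (Suc k)) + phi_term n w (- int (Suc k)))"
    unfolding sum_symmetric_int by (intro tendsto_add tendsto_const summable_LIMSEQ)
  then show ?thesis unfolding phi_def by (simp add: limI)
qed

end

theory Submission
  imports Defs
begin

text \<open>With a = k^(2^(n-1)) and b = z^(2^(n-1)), the general term is 1/(a^2 + b^2), which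
  splits over the factors a - ib and a + ib. Both -ib and ib are themselves 2^(n-1)-th powers, of
  the two rotated copies of z (\<open>i_powr_root_power\<close>), so each partial fraction is a term
  of the series at level n-1. The identity thus holds term by term and passes to the limit of
  symmetric partial sums.\<close>

lemma i_powr_root_power:
  fixes j n :: nat
  assumes "n \<ge> 1"
  shows "(\<i> powr (of_nat j * 2 powi (1 - int n))) ^ (2 ^ (n - 1)) = \<i> ^ j"
proof -
  have "1 - int n = - int (n - 1)" using assms by simp
  then have inv: "(2 :: complex) powi (1 - int n) = inverse (2 ^ (n - 1))"
    by (simp only: power_int_minus power_int_of_nat)
  \<comment> \<open>A natural power only multiplies the argument of \<open>exp\<close>, so no branch
    question arises.\<close>
  have "(\<i> powr (of_nat j * 2 powi (1 - int n))) ^ (2 ^ (n - 1))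
      = exp (of_nat (2 ^ (n - 1)) * (of_nat j * 2 powi (1 - int n) * Ln \<i>))"
    unfolding exp_of_nat_mult by (simp add: powr_def)
  also have "of_nat (2 ^ (n - 1)) * (of_nat j * 2 powi (1 - int n) * Ln \<i>) = of_nat j * Ln \<i>"
    unfolding inv by (simp add: field_simps)
  also have "exp (of_nat j * Ln \<i>) = \<i> ^ j"
    unfolding exp_of_nat_mult by (subst exp_Ln) simp_all
  finally show ?thesis .
qed

text \<open>The denominators are written as sums \<open>a + c * b\<close> so that they match
  \<open>phi_term\<close> at the rotated arguments.\<close>

lemma inverse_sum_squares_partial_fraction:
  fixes a b :: complex
  assumes "b \<noteq> 0" and "a\<^sup>2 + b\<^sup>2 \<noteq> 0"
  shows "1 / (a\<^sup>2 + b\<^sup>2) = (1 / (a + - \<i> * b) - 1 / (a + \<i> * b)) / (2 * \<i> * b)"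
proof -
  have fac: "a\<^sup>2 + b\<^sup>2 = (a + - \<i> * b) * (a + \<i> * b)"
    by (simp add: power2_eq_square algebra_simps)
  with assms(2) have ne: "a + - \<i> * b \<noteq> 0" "a + \<i> * b \<noteq> 0" by auto
  have "1 / (a + - \<i> * b) - 1 / (a + \<i> * b)
      = ((a + \<i> * b) - (a + - \<i> * b)) / ((a + - \<i> * b) * (a + \<i> * b))"
    using diff_frac_eq[OF ne, of 1 1] by simp
  also have "\<dots> = 2 * \<i> * b / (a\<^sup>2 + b\<^sup>2)" unfolding fac by simp
  finally show ?thesis using assms(1) by simp
qed

theorem theorem2p6:
  fixes n :: nat and z :: complex
  assumes "n \<ge> 1"
    and "Re z \<noteq> 0"
    and "\<And>k :: int. of_int k ^ (2 ^ n) + z ^ (2 ^ n) \<noteq> 0"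
  shows "phi n z =
    (phi (n - 1) (\<i> powr (3 * 2 powi (1 - int n)) * z) - phi (n - 1) (\<i> powr (2 powi (1 - int n)) * z))
      / (2 * \<i> * z ^ (2 ^ (n - 1)))"
    (is "_ = (phi _ ?u - phi _ ?v) / ?c")
proof -
  \<comment> \<open>The case j = 3, where i^3 = -i.\<close>
  have u: "?u ^ (2 ^ (n - 1)) = - \<i> * z ^ (2 ^ (n - 1))"
    using i_powr_root_power[OF assms(1), of 3] by (simp add: power_mult_distrib power3_eq_cube)
  have v: "?v ^ (2 ^ (n - 1)) = \<i> * z ^ (2 ^ (n - 1))"
    using i_powr_root_power[OF assms(1), of 1] by (simp add: power_mult_distrib)
  have "z \<noteq> 0" using assms(2) by auto
  have sq: "x ^ (2 ^ n) = (x ^ (2 ^ (n - 1)))\<^sup>2" for x :: complex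
    using assms(1) by (cases n) (simp_all add: power_mult[symmetric] mult.commute)
  have "phi_term n z k = (phi_term (n - 1) ?u k - phi_term (n - 1) ?v k) / ?c" for k
    unfolding phi_term_def u v sq
    using \<open>z \<noteq> 0\<close> assms(3)[of k]
    by (intro inverse_sum_squares_partial_fraction) (simp_all add: sq)
  \<comment> \<open>The difference is split inside finite sums: for n = 1 the two series on the
    right converge only as principal values, which \<open>phi_LIMSEQ\<close> covers.\<close>
  then have "(\<lambda>N. \<Sum>k = - int N..int N. phi_term n z k)
      = (\<lambda>N. ((\<Sum>k = - int N..int N. phi_term (n - 1) ?u k)
            - (\<Sum>k = - int N..int N. phi_term (n - 1) ?v k)) / ?c)"
    by (simp only: sum_subtractf[symmetric] sum_divide_distrib)
  also have "\<dots> \<longlonglongrightarrow> (phi (n - 1) ?u - phi (n - 1) ?v) / ?c"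
    using \<open>z \<noteq> 0\<close> by (intro tendsto_divide tendsto_diff tendsto_const phi_LIMSEQ) auto
  finally show ?thesis
    by (rule LIMSEQ_unique[OF phi_LIMSEQ])
qed

end
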